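(* For FIFO queues, the competitive ratio of the deterministic algorithm FIFOQueEH with parameters $\alpha=\frac34$ and $\beta=\frac23$ is at most $1.8$.
   Context: Dynamic set problem: each item $x$ has a weight $w_x\ge 0$; time proceeds in steps; before each step items may be inserted into or deleted from a dynamic set $\mathcal{S}$; an item is active if inserted and not yet deleted; at each step an algorithm may collect at most one active item it has not collected before (pending items); the gain is the total weight collected. A deterministic online algorithm is $R$-competitive if on every instance its gain is at least $\mathrm{OPT}/R$ ($\mathrm{OPT}$ = maximum achievable gain). Dynamic queue: $\mathcal{S}$ is a linearly ordered list; only a prefix of the current list may be deleted. FIFO queue: a dynamic queue in which new items are inserted only at the end of the list. Algorithm FIFOQueEH with parameters $0<\alpha,\beta<1$ (assume w.l.o.g. a pending item always exists, e.g. by padding with zero-weight items): it maintains a reference item $h'$ (initially an imaginary item of weight $0$ that is never pending). At each step let $h$ be the heaviest pending item. If $h'$ is not pending, or $h'$ is pending and $\alpha w_h\ge w_{h'}$, then collect the earliest (in queue order) pending item $e$ with $w_e\ge\beta w_h$, and $h$ becomes the new reference item $h'$; otherwise collect $h'$. *)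

theory Defs
  imports Complex_Main
begin

text \<open>
  Two items are the same iff both identifier and weight agree; the identifier lets different
  items have equal weights. Storing the weight in the item makes it part of
  what is revealed to an online algorithm, and only upon insertion.
\<close>

datatype item = Item (ident: nat) (weight: real)

text \<open>
  \<open>Insert i x\<close> puts \<open>x\<close> at position \<open>i\<close> of the list, \<open>Delete k\<close> removes the prefix of length \<open>k\<close>
  (the whole list if it is shorter).
\<close>

datatype update = Insert nat item | Delete nat

fun apply_update :: "item list \<Rightarrow> update \<Rightarrow> item list" where
  "apply_update q (Insert i x) = take i q @ x # drop i q"
| "apply_update q (Delete k) = drop k q"

definition queue_after :: "update list \<Rightarrow> item list" where
  "queue_after us = foldl apply_update [] us"

text \<open>
  An input consists of one (possibly empty) batch of updates per step; batch \<open>t\<close> takes place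
  immediately before step \<open>t\<close>, and steps are numbered from \<open>0\<close>.
\<close>

type_synonym input = "update list list"

definition queue_at :: "input \<Rightarrow> nat \<Rightarrow> item list" where
  "queue_at I t = queue_after (concat (take (Suc t) I))"

fun inserted :: "update list \<Rightarrow> item list" where
  "inserted [] = []"
| "inserted (Insert i x # us) = x # inserted us"
| "inserted (Delete k # us) = inserted us"

definition dynamic_queue :: "input \<Rightarrow> bool" where
  "dynamic_queue I \<longleftrightarrow>
     distinct (inserted (concat I)) \<and>
     (\<forall>x \<in> set (inserted (concat I)). 0 \<le> weight x) \<and>
     (\<forall>us i x vs. concat I = us @ Insert i x # vs \<longrightarrow> i \<le> length (queue_after us))"

definition fifo_queue :: "input \<Rightarrow> bool" where
  "fifo_queue I \<longleftrightarrow>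
     dynamic_queue I \<and>
     (\<forall>us i x vs. concat I = us @ Insert i x # vs \<longrightarrow> i = length (queue_after us))"

text \<open>
  A solution lists, for each step, the collected item, or \<open>None\<close> if nothing is collected.
\<close>

definition feasible :: "input \<Rightarrow> item option list \<Rightarrow> bool" where
  "feasible I cs \<longleftrightarrow>
     length cs = length I \<and>
     (\<forall>t < length I. \<forall>x. cs ! t = Some x \<longrightarrow>
        x \<in> set (queue_at I t) \<and> (\<forall>s < t. cs ! s \<noteq> Some x))"

definition gain :: "item option list \<Rightarrow> real" where
  "gain cs = (\<Sum>c\<leftarrow>cs. case c of None \<Rightarrow> 0 | Some x \<Rightarrow> weight x)"

definition opt :: "input \<Rightarrow> real" where
  "opt I = Max (gain ` {cs. feasible I cs})"

lemma finite_feasible: "finite {cs. feasible I cs}"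
proof -
  let ?A = "insert None (Some ` (\<Union>t<length I. set (queue_at I t)))"
  have "{cs. feasible I cs} \<subseteq> {cs. set cs \<subseteq> ?A \<and> length cs = length I}"
  proof (intro subsetI, clarify, intro conjI subsetI)
    fix cs c assume f: "feasible I cs" and "c \<in> set cs"
    then obtain t where t: "t < length I" "c = cs ! t"
      by (auto simp: feasible_def in_set_conv_nth)
    show "c \<in> ?A"
    proof (cases c)
      case (Some x)
      with f t have "x \<in> set (queue_at I t)"
        unfolding feasible_def by metis
      with t Some show ?thesis by blast
    qed simp
  qed (simp add: feasible_def)
  moreover have "finite {cs. set cs \<subseteq> ?A \<and> length cs = length I}"
    by (rule finite_lists_length_eq) simp
  ultimately show ?thesis by (rule finite_subset)
qed

lemma feasible_idle: "feasible I (replicate (length I) None)"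
  by (simp add: feasible_def)

text \<open>
  A deterministic online algorithm maps the batches revealed so far to its action in the
  current step, which is the step immediately after the last of these batches.
\<close>

type_synonym online_algorithm = "input \<Rightarrow> item option"

definition outcome :: "online_algorithm \<Rightarrow> input \<Rightarrow> item option list" where
  "outcome A I = map (\<lambda>t. A (take (Suc t) I)) [0..<length I]"

definition competitive :: "real \<Rightarrow> input set \<Rightarrow> online_algorithm \<Rightarrow> bool" where
  "competitive R \<I> A \<longleftrightarrow>
     0 < R \<and> (\<forall>I \<in> \<I>. feasible I (outcome A I) \<and> gain (outcome A I) \<ge> opt I / R)"

text \<open>
  The heaviest pending item need not be unique. A tie-breaking rule selects one of them,
  given the batches revealed so far and the list of pending items in queue order.
\<close>

type_synonym tie_breaking = "input \<Rightarrow> item list \<Rightarrow> item"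

definition selects_heaviest :: "tie_breaking \<Rightarrow> bool" where
  "selects_heaviest sel \<longleftrightarrow>
     (\<forall>H P. P \<noteq> [] \<longrightarrow> sel H P \<in> set P \<and> (\<forall>x \<in> set P. weight x \<le> weight (sel H P)))"

text \<open>
  One step with pending items \<open>P\<close>, heaviest pending item \<open>h\<close> and reference item \<open>r\<close>;
  returns the collected item and the new reference item. The initial imaginary
  reference item is \<open>None\<close>. If nothing is pending, the step is idle.
\<close>

definition eh_step ::
    "real \<Rightarrow> real \<Rightarrow> item list \<Rightarrow> item \<Rightarrow> item option \<Rightarrow> item option \<times> item option" where
  "eh_step \<alpha> \<beta> P h r =
     (if P = [] then (None, r)
      else if r \<notin> Some ` set P \<or> \<alpha> * weight h \<ge> weight (the r)
      then (find (\<lambda>e. weight e \<ge> \<beta> * weight h) P, Some h)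
      else (r, r))"

text \<open>The items collected in the first \<open>t\<close> steps, together with the reference item after them.\<close>

primrec eh_state ::
    "real \<Rightarrow> real \<Rightarrow> tie_breaking \<Rightarrow> input \<Rightarrow> nat \<Rightarrow> item option list \<times> item option" where
  "eh_state \<alpha> \<beta> sel I 0 = ([], None)"
| "eh_state \<alpha> \<beta> sel I (Suc t) =
     (let (cs, r) = eh_state \<alpha> \<beta> sel I t;
          P = filter (\<lambda>x. Some x \<notin> set cs) (queue_at I t);
          (c, r') = eh_step \<alpha> \<beta> P (sel (take (Suc t) I) P) r
      in (cs @ [c], r'))"

definition fifo_queue_eh :: "real \<Rightarrow> real \<Rightarrow> tie_breaking \<Rightarrow> online_algorithm" where
  "fifo_queue_eh \<alpha> \<beta> sel H = last (fst (eh_state \<alpha> \<beta> sel H (length H)))"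

end

theory Submission
  imports Defs
begin

text \<open>
  By exchanging inversions, an optimal adversary may be assumed to collect items in queue order.
  Its items are charged to steps of the algorithm, and we track the slack, that is \<open>9/5\<close> times
  the algorithm's gain minus the charges so far. Call a maximal run of steps ending when the current
  reference item is collected or deleted a chain. Within a chain the slack becomes negative only if
  the algorithm collects an item \<open>e\<close> that the adversary takes later, while the adversary takes an
  item before \<open>e\<close>; such an item is lighter than \<open>2/3\<close> of the heaviest pending one. As long as
  \<open>e\<close> is due, the adversary remains confined to these light items, whereas every further step
  of the chain yields the algorithm an item from a maximum grown by a factor \<open>4/3\<close>, or the
  reference item itself, which repays the debt. If the reference item is deleted, so is \<open>e\<close>, and
  then there was no debt.
\<close>

section \<open>The game on a sliding window of positions\<close>

text \<open>A FIFO queue is a window of the insertion sequence, with \<open>d t\<close> items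
  deleted and \<open>n t\<close> inserted so far; both ends only move right. The heaviest item in
  \<open>step\<close> is existential, so that every tie-breaking rule fits.\<close>

locale fifo_game =
  fixes w :: "'a \<Rightarrow> real" and pos :: "'a \<Rightarrow> nat" and U :: "'a set"
    and d n :: "nat \<Rightarrow> nat" and T :: nat
    and alg adv ref :: "nat \<Rightarrow> 'a option"
  fixes Q pend :: "nat \<Rightarrow> 'a set"
  defines "Q t \<equiv> {x \<in> U. d t \<le> pos x \<and> pos x < n t}"
    and "pend t \<equiv> {x \<in> Q t. \<forall>s<t. alg s \<noteq> Some x}"
  assumes mono_d: "mono d" and mono_n: "mono n"
    and inj_pos: "inj_on pos U"
    and w_nonneg: "x \<in> U \<Longrightarrow> 0 \<le> w x"
    and adv_active: "t < T \<Longrightarrow> adv t = Some x \<Longrightarrow> x \<in> Q t"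
    and adv_ordered: "s < t \<Longrightarrow> t < T \<Longrightarrow> adv s = Some x \<Longrightarrow> adv t = Some y \<Longrightarrow> pos x < pos y"
    and ref_0: "ref 0 = None"
    and idle_step: "t < T \<Longrightarrow> pend t = {} \<Longrightarrow> alg t = None \<and> ref (Suc t) = ref t"
    and step: "t < T \<Longrightarrow> pend t \<noteq> {} \<Longrightarrow>
      \<exists>h \<in> pend t. (\<forall>x \<in> pend t. w x \<le> w h) \<and>
        (if ref t \<notin> Some ` pend t \<or> 3/4 * w h \<ge> w (the (ref t))
         then ref (Suc t) = Some h \<and>
           (\<exists>e \<in> pend t. alg t = Some e \<and> 2/3 * w h \<le> w e \<and>
              (\<forall>x \<in> pend t. pos x < pos e \<longrightarrow> w x < 2/3 * w h))
         else alg t = ref t \<and> ref (Suc t) = ref t)"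
begin

section \<open>Charges, slack and the invariant\<close>

definition val :: "'a option \<Rightarrow> real" where
  "val c = (case c of None \<Rightarrow> 0 | Some x \<Rightarrow> w x)"

lemma val_simps [simp]: "val None = 0" "val (Some x) = w x"
  by (simp_all add: val_def)

text \<open>An item collected by the adversary is charged to the step in which the algorithm collects it
  if that step is earlier (\<open>later\<close>), and to the adversary's own step otherwise (\<open>own\<close>).\<close>

definition own :: "nat \<Rightarrow> real" where
  "own t = (if \<forall>s<t. alg s \<noteq> adv t then val (adv t) else 0)"

definition later :: "nat \<Rightarrow> bool" where
  "later t \<longleftrightarrow> alg t \<noteq> None \<and> (\<exists>u. t < u \<and> u < T \<and> adv u = alg t)"

definition charge :: "nat \<Rightarrow> real" where
  "charge t = own t + (if later t then val (alg t) else 0)"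

definition slack :: "nat \<Rightarrow> real" where
  "slack t = (\<Sum>s<t. 9/5 * val (alg s) - charge s)"

lemma slack_Suc: "slack (Suc t) = slack t + 9/5 * val (alg t) - charge t"
  by (simp add: slack_def)

lemma slack_0: "slack 0 = 0"
  by (simp add: slack_def)

text \<open>\<open>e\<close> stands for an item collected in an earlier step of the current chain, \<open>v\<close> for the weight of
  the heaviest pending item in that step. Until the adversary collects \<open>e\<close> it is confined to items
  preceding \<open>e\<close>, which weigh at most \<open>2/3 * v\<close> unless the algorithm already has them.\<close>

definition outstanding :: "nat \<Rightarrow> 'a \<Rightarrow> real \<Rightarrow> bool" where
  "outstanding t e v \<longleftrightarrow>
     e \<in> U \<and> (\<exists>s<t. alg s = Some e) \<and> (\<exists>u. t \<le> u \<and> u < T \<and> adv u = Some e) \<and> 0 \<le> v \<and>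
     (\<forall>x \<in> U. pos x < pos e \<longrightarrow> (\<forall>s<t. alg s \<noteq> Some x) \<longrightarrow> d t \<le> pos x \<longrightarrow> w x \<le> 2/3 * v)"

text \<open>The constant \<open>2/15\<close> is \<open>2/3 * (1 - 4/5)\<close>: a step with weight \<open>2/3 * v\<close> that is charged
  twice, against a budget of \<open>9/5\<close>, overdraws by \<open>1/5\<close> of its weight.\<close>

definition invariant :: "nat \<Rightarrow> bool" where
  "invariant t \<longleftrightarrow>
    (case ref t of None \<Rightarrow> 0 \<le> slack t
     | Some h \<Rightarrow> h \<in> U \<and>
       (if \<exists>s<t. alg s = Some h then 0 \<le> slack t
        else (\<forall>x \<in> U. pos x < pos h \<longrightarrow> (\<forall>s<t. alg s \<noteq> Some x) \<longrightarrow> d t \<le> pos x \<longrightarrow> w x \<le> w h) \<and>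
          (\<exists>s<t. pos h < n s) \<and>
          (w h / 5 \<le> slack t \<or>
           (\<exists>e v. outstanding t e v \<and> pos e < pos h \<and> v \<le> w h \<and> - (2/15) * v \<le> slack t))))"

text \<open>A nonzero own charge comes from an item that is active and not yet collected by the
  algorithm, hence pending.\<close>

lemma own_le:
  assumes "t < T" "\<And>x. x \<in> pend t \<Longrightarrow> adv t = Some x \<Longrightarrow> w x \<le> b" "0 \<le> b"
  shows "own t \<le> b"
  using assms adv_active[OF assms(1)] unfolding own_def pend_def
  by (cases "adv t") auto

text \<open>The adversary takes \<open>e\<close> after step \<open>t\<close>, so its current item
  must precede \<open>e\<close>.\<close>

lemma own_le_later:
  assumes "t < T" "later t" "alg t = Some e" "0 \<le> b"
    "\<And>x. x \<in> pend t \<Longrightarrow> pos x < pos e \<Longrightarrow> w x \<le> b"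
  shows "own t \<le> b"
  using assms adv_ordered[of t] by (intro own_le) (auto simp: later_def)

text \<open>A pending item is not \<open>e\<close>, which the algorithm already has. If the
  adversary takes one now, \<open>e\<close> is still due afterwards, so that item precedes
  \<open>e\<close> and falls under the bound in \<open>outstanding\<close>.\<close>

lemma own_le_outstanding:
  assumes "t < T" "outstanding t e v"
  shows "own t \<le> 2/3 * v"
proof (rule own_le[OF assms(1)])
  fix x assume x: "x \<in> pend t" "adv t = Some x"
  from assms(2) obtain u where u: "t \<le> u" "u < T" "adv u = Some e"
    and s: "\<exists>s<t. alg s = Some e" unfolding outstanding_def by blast
  from s x have "x \<noteq> e" by (auto simp: pend_def)
  with u x have "t < u" by (metis le_neq_implies_less option.inject)
  with adv_ordered u x have "pos x < pos e" by blast
  with assms(2) x show "w x \<le> 2/3 * v"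
    unfolding outstanding_def pend_def Q_def by auto
qed (use assms in \<open>auto simp: outstanding_def\<close>)

lemma own_outstanding_now:
  assumes "outstanding t e v" "adv t = Some e"
  shows "own t = 0"
  using assms unfolding outstanding_def own_def by auto

lemma outstanding_Suc:
  assumes "outstanding t e v" "adv t \<noteq> Some e"
  shows "outstanding (Suc t) e v"
proof -
  obtain u where u: "t \<le> u" "u < T" "adv u = Some e"
    using assms unfolding outstanding_def by blast
  with assms have "Suc t \<le> u" by (metis le_neq_implies_less Suc_leI)
  moreover have "d t \<le> d (Suc t)" using mono_d by (simp add: monoD)
  ultimately show ?thesis using assms u unfolding outstanding_def
    by (smt (verit, best) less_Suc_eq order_trans)
qed

text \<open>Arrivals only at the end matter here: positions before the pending \<open>e\<close> lie
  below \<open>n t\<close>, so no later arrival precedes \<open>e\<close> and a bound on the present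
  pending items suffices.\<close>

lemma outstanding_new:
  assumes "t < T" "e \<in> pend t" "alg t = Some e" "later t" "0 \<le> v"
    and "\<And>x. x \<in> pend t \<Longrightarrow> pos x < pos e \<Longrightarrow> w x \<le> 2/3 * v"
  shows "outstanding (Suc t) e v"
proof -
  have "d t \<le> d (Suc t)" using mono_d by (simp add: monoD)
  with assms show ?thesis unfolding outstanding_def later_def pend_def Q_def
    by (auto simp: less_Suc_eq Suc_le_eq)
qed

text \<open>Only a prefix is deleted, so the reference item outlives \<open>e\<close>.\<close>

lemma outstanding_ref_pending:
  assumes "outstanding t e v" "pos e < pos h" "h \<in> U" "\<exists>s<t. pos h < n s"
    "\<forall>s<t. alg s \<noteq> Some h"
  shows "h \<in> pend t"
proof -
  obtain u where u: "t \<le> u" "u < T" "adv u = Some e"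
    using assms unfolding outstanding_def by blast
  from adv_active[OF u(2,3)] have "d u \<le> pos e" by (simp add: Q_def)
  moreover have "d t \<le> d u" using mono_d u(1) by (simp add: monoD)
  moreover from assms(4) obtain s where "s < t" "pos h < n s" by blast
  moreover from this have "n s \<le> n t" using mono_n by (simp add: monoD)
  ultimately show ?thesis using assms by (auto simp: pend_def Q_def)
qed

section \<open>Preservation of the invariant\<close>

text \<open>If the reference item was deleted uncollected, a debt is impossible: its outstanding
  item would keep the reference item pending. So the reserve \<open>w h / 5\<close> is
  there.\<close>

lemma inv_slack_nonneg:
  assumes "invariant t" "ref t \<notin> Some ` pend t"
  shows "0 \<le> slack t"
proof (cases "ref t")
  case None then show ?thesis using assms by (simp add: invariant_def)
next
  case (Some h)
  show ?thesis
  proof (cases "\<exists>s<t. alg s = Some h")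
    case True then show ?thesis using assms Some by (simp add: invariant_def)
  next
    case False
    then have "h \<in> U" "\<exists>s<t. pos h < n s" and
      *: "w h / 5 \<le> slack t \<or> (\<exists>e v. outstanding t e v \<and> pos e < pos h)"
      using assms(1) unfolding invariant_def Some option.case if_not_P[OF False] by blast+
    moreover have "h \<notin> pend t" using assms(2) Some by blast
    ultimately have "w h / 5 \<le> slack t"
      using outstanding_ref_pending False by blast
    with w_nonneg[OF \<open>h \<in> U\<close>] show ?thesis by simp
  qed
qed

lemma inv_idle:
  assumes "t < T" "pend t = {}" "invariant t"
  shows "invariant (Suc t)"
proof -
  note idle = idle_step[OF assms(1,2)]
  have "own t = 0" using adv_active[OF assms(1)] assms(2)
    unfolding own_def pend_def by (cases "adv t") auto
  with idle have S: "slack (Suc t) = slack t"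
    by (simp add: slack_Suc charge_def later_def)
  have d: "d t \<le> d (Suc t)" using mono_d by (simp add: monoD)
  show ?thesis
  proof (cases "ref t")
    case None then show ?thesis using idle assms(3) S by (simp add: invariant_def)
  next
    case (Some h)
    have "0 \<le> slack t" using inv_slack_nonneg assms by auto
    show ?thesis
    proof (cases "\<exists>s<t. alg s = Some h")
      case True
      then have "\<exists>s<Suc t. alg s = Some h" using less_Suc_eq by auto
      then show ?thesis using assms idle Some S \<open>0 \<le> slack t\<close> by (simp add: invariant_def)
    next
      case False
      with assms(3) Some have "h \<in> U" "\<exists>s<t. pos h < n s" and
        X: "\<forall>x \<in> U. pos x < pos h \<longrightarrow> (\<forall>s<t. alg s \<noteq> Some x) \<longrightarrow> d t \<le> pos x \<longrightarrow> w x \<le> w h" and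
        *: "w h / 5 \<le> slack t \<or> (\<exists>e v. outstanding t e v \<and> pos e < pos h)"
        unfolding invariant_def by auto
      with False assms(2) have "w h / 5 \<le> slack t"
        using outstanding_ref_pending by blast
      then show ?thesis using False Some idle S \<open>h \<in> U\<close> \<open>\<exists>s<t. pos h < n s\<close> X d
        unfolding invariant_def by (auto simp: less_Suc_eq) 
    qed
  qed
qed

lemma inv_ref_collected:
  assumes "ref (Suc t) = Some h" "h \<in> U" "alg t = Some h" "0 \<le> slack (Suc t)"
  shows "invariant (Suc t)"
  using assms unfolding invariant_def by auto

text \<open>All positions before \<open>h\<close> have arrived already, so what is left there is
  pending now and bounded by the maximum \<open>w h\<close>.\<close>

lemma inv_ref_new:
  assumes "ref (Suc t) = Some h" "h \<in> pend t" "alg t \<noteq> Some h" "\<And>x. x \<in> pend t \<Longrightarrow> w x \<le> w h"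
    and "w h / 5 \<le> slack (Suc t) \<or>
      (\<exists>e v. outstanding (Suc t) e v \<and> pos e < pos h \<and> v \<le> w h \<and> - (2/15) * v \<le> slack (Suc t))"
  shows "invariant (Suc t)"
proof -
  have "d t \<le> d (Suc t)" using mono_d by (simp add: monoD)
  then have "\<forall>x \<in> U. pos x < pos h \<longrightarrow> (\<forall>s<Suc t. alg s \<noteq> Some x) \<longrightarrow> d (Suc t) \<le> pos x \<longrightarrow> w x \<le> w h"
    using assms(2,4) by (auto simp: pend_def Q_def)
  then show ?thesis using assms unfolding invariant_def by (auto simp: pend_def Q_def less_Suc_eq)
qed

text \<open>With nonnegative slack the step stands on its own. With a debt, the old reference item
  is pending and was given up, so \<open>v \<le> 3/4 * w h\<close>, and the debt is small against
  the new gain.\<close>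

lemma inv_step_E:
  assumes t: "t < T" and invariant: "invariant t"
    and h: "h \<in> pend t" "\<And>x. x \<in> pend t \<Longrightarrow> w x \<le> w h"
    and cond: "ref t \<notin> Some ` pend t \<or> 3/4 * w h \<ge> w (the (ref t))"
    and r: "ref (Suc t) = Some h"
    and e: "e \<in> pend t" "alg t = Some e" "2/3 * w h \<le> w e"
      "\<And>x. x \<in> pend t \<Longrightarrow> pos x < pos e \<Longrightarrow> w x < 2/3 * w h"
  shows "invariant (Suc t)"
proof -
  have hU: "h \<in> U" and eU: "e \<in> U" using h e by (auto simp: pend_def Q_def)
  have h0: "0 \<le> w h" and e0: "0 \<le> w e" using w_nonneg hU eU by auto
  have S: "slack (Suc t) = slack t + 9/5 * w e - own t - (if later t then w e else 0)"
    using e by (simp add: slack_Suc charge_def)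
  have eh: "pos e < pos h" if "e \<noteq> h"
  proof -
    \<comment> \<open>\<open>h\<close> itself meets the threshold \<open>2/3 * w h\<close>, and
      \<open>e\<close> is the earliest item that does.\<close>
    have "\<not> pos h < pos e" using e(4)[OF h(1)] h0 by auto
    with that inj_pos hU eU show ?thesis by (metis inj_onD linorder_neqE_nat)
  qed
  \<comment> \<open>If \<open>e = h\<close>, the chain closes at once. Otherwise either the reserve
    is in place or \<open>e\<close> becomes outstanding with \<open>v = w h\<close>.\<close>
  have fresh: "invariant (Suc t)"
    if "w h / 5 \<le> slack (Suc t) \<or> later t \<and> - (2/15) * w h \<le> slack (Suc t)"
      and "e = h \<Longrightarrow> 0 \<le> slack (Suc t)"
  proof (cases "e = h")
    case True then show ?thesis using that inv_ref_collected r hU e by blast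
  next
    case False
    have "outstanding (Suc t) e (w h)" if "later t"
      using that e h0 t by (intro outstanding_new) (auto intro: less_imp_le)
    then show ?thesis using False r h e eh that by (intro inv_ref_new) auto
  qed
  have own_h: "own t \<le> w h" using h h0 t by (intro own_le) auto
  have own_later: "own t \<le> 2/3 * w h" if "later t"
    using that e h0 t by (intro own_le_later) (auto intro: less_imp_le)
  show ?thesis
  proof (cases "0 \<le> slack t")
    case True
    \<comment> \<open>Tight for \<open>w e = 2/3 * w h\<close> if \<open>e \<noteq> h\<close>:
      without a later charge \<open>9/5 * 2/3 - 1 = 1/5\<close>, with one
      \<open>4/5 * 2/3 - 2/3 = -2/15\<close>.\<close>
    show ?thesis using fresh True own_h own_later S e h0
      by (cases "later t") (auto simp: field_simps)
  next
    case neg: False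
    with inv_slack_nonneg invariant obtain g where g: "ref t = Some g" "g \<in> pend t" by fastforce
    then have gn: "\<not> (\<exists>s<t. alg s = Some g)" and gU: "g \<in> U" by (auto simp: pend_def Q_def)
    have g0: "0 \<le> w g" using w_nonneg gU by auto
    with invariant g gn neg obtain f v where f: "outstanding t f v" "pos f < pos g" "v \<le> w g"
        "- (2/15) * v \<le> slack t"
      and X: "\<forall>x \<in> U. pos x < pos g \<longrightarrow> (\<forall>s<t. alg s \<noteq> Some x) \<longrightarrow> d t \<le> pos x \<longrightarrow> w x \<le> w g"
      unfolding invariant_def by auto
    have gh: "w g \<le> 3/4 * w h" using cond g by auto
    have v0: "0 \<le> v" using f by (auto simp: outstanding_def)
    show ?thesis
    proof (cases "adv t = Some f")
      case True
      with f own_outstanding_now have "own t = 0" by blast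
      \<comment> \<open>Even with a later charge the factor of \<open>w h\<close> is at least
        \<open>8/15 - 2/15 * 3/4 = 13/30\<close>, above the reserve \<open>1/5\<close>.\<close>
      then show ?thesis using fresh f v0 gh S e h0 by (auto simp: field_simps split: if_splits)
    next
      case False
      have own_v: "own t \<le> 2/3 * v" using own_le_outstanding f t by blast
      show ?thesis
      proof (cases "later t \<and> e \<noteq> h")
        case False
        \<comment> \<open>Debt and own charge amount to at most
          \<open>4/5 * v \<le> 3/5 * w h\<close>. Without a later charge the gain is at least
          \<open>6/5 * w h\<close>; with one, \<open>e = h\<close> leaves
          \<open>4/5 * w h\<close>.\<close>
        then show ?thesis using fresh f v0 gh S e h0 own_v by (auto simp: field_simps split: if_splits)
      next
        case True
        \<comment> \<open>Otherwise \<open>v = 0\<close> and there would be no debt. The strict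
          inequality \<open>w g < w h\<close> then rules out that \<open>h\<close> precedes
          \<open>g\<close>.\<close>
        have "w h \<noteq> 0" using neg f v0 gh h0 by auto
        then have "w g < w h" using gh h0 by auto
        with X h have "\<not> pos h < pos g" by (auto simp: pend_def Q_def)
        with f have "pos f < pos h" by auto
        moreover have "outstanding (Suc t) f v" using outstanding_Suc f \<open>adv t \<noteq> Some f\<close> by blast
        moreover have "v \<le> w h" using f gh h0 by auto
        \<comment> \<open>The pair \<open>f\<close>, \<open>v\<close> is kept:
          \<open>4/5 * w e\<close>, at least \<open>8/15 * w h\<close>, covers the own charge of at
          most \<open>2/3 * v \<le> 1/2 * w h\<close>, so the debt does not grow.\<close>
        moreover have "- (2/15) * v \<le> slack (Suc t)" using f v0 gh S e h0 own_v True by auto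
        ultimately show ?thesis using True r h e by (intro inv_ref_new) auto
      qed
    qed
  qed
qed

text \<open>Two charges of at most \<open>w g\<close> against \<open>9/5 * w g\<close> overdraw by
  \<open>w g / 5\<close>, exactly the reserve. In the debt case,
  \<open>2/15 * v + 2/3 * v = 4/5 * v\<close> is paid by the \<open>4/5 * w g\<close> left after a
  later charge.\<close>

lemma inv_step_H:
  assumes t: "t < T" and invariant: "invariant t"
    and h: "\<And>x. x \<in> pend t \<Longrightarrow> w x \<le> w h"
    and g: "ref t = Some g" "g \<in> pend t" "3/4 * w h < w g"
    and r: "ref (Suc t) = Some g" "alg t = Some g"
  shows "invariant (Suc t)"
proof (rule inv_ref_collected)
  have gn: "\<not> (\<exists>s<t. alg s = Some g)" and gU: "g \<in> U" using g by (auto simp: pend_def Q_def)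
  have g0: "0 \<le> w g" using w_nonneg gU by auto
  have X: "\<forall>x \<in> U. pos x < pos g \<longrightarrow> (\<forall>s<t. alg s \<noteq> Some x) \<longrightarrow> d t \<le> pos x \<longrightarrow> w x \<le> w g"
    and cases: "w g / 5 \<le> slack t \<or>
      (\<exists>e v. outstanding t e v \<and> pos e < pos g \<and> v \<le> w g \<and> - (2/15) * v \<le> slack t)"
    using invariant g gn unfolding invariant_def by auto
  have S: "slack (Suc t) = slack t + 9/5 * w g - own t - (if later t then w g else 0)"
    using r by (simp add: slack_Suc charge_def)
  \<comment> \<open>\<open>4/3\<close> is the inverse of the parameter \<open>3/4\<close>.\<close>
  have own_g: "own t \<le> 4/3 * w g" using h g g0 t by (intro own_le) fastforce+
  have own_later: "own t \<le> w g" if "later t"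
    using that r t g0 X by (intro own_le_later) (auto simp: pend_def Q_def)
  from cases show "0 \<le> slack (Suc t)"
  proof
    assume "w g / 5 \<le> slack t"
    then show ?thesis using S own_g own_later g0 by (cases "later t") auto
  next
    assume "\<exists>e v. outstanding t e v \<and> pos e < pos g \<and> v \<le> w g \<and> - (2/15) * v \<le> slack t"
    then obtain e v where "outstanding t e v" "v \<le> w g" "- (2/15) * v \<le> slack t" by blast
    moreover from this t have "own t \<le> 2/3 * v" by (intro own_le_outstanding)
    moreover have "0 \<le> v" using \<open>outstanding t e v\<close> by (simp add: outstanding_def)
    ultimately show ?thesis using S g0 by (cases "later t") auto
  qed
  show "g \<in> U" by (rule gU)
qed (use r in auto)

lemma inv_Suc:
  assumes "t < T" "invariant t"
  shows "invariant (Suc t)"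
proof (cases "pend t = {}")
  case True then show ?thesis using inv_idle assms by blast
next
  case False
  from step[OF assms(1) False] obtain h where h: "h \<in> pend t" "\<And>x. x \<in> pend t \<Longrightarrow> w x \<le> w h"
    and st: "if ref t \<notin> Some ` pend t \<or> 3/4 * w h \<ge> w (the (ref t))
         then ref (Suc t) = Some h \<and>
           (\<exists>e \<in> pend t. alg t = Some e \<and> 2/3 * w h \<le> w e \<and>
              (\<forall>x \<in> pend t. pos x < pos e \<longrightarrow> w x < 2/3 * w h))
         else alg t = ref t \<and> ref (Suc t) = ref t" by blast
  show ?thesis
  proof (cases "ref t \<notin> Some ` pend t \<or> 3/4 * w h \<ge> w (the (ref t))")
    case True
    with st show ?thesis using inv_step_E[OF assms h True] by auto
  next
    case False
    then obtain g where "ref t = Some g" "g \<in> pend t" "3/4 * w h < w g" by auto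
    with st False show ?thesis using inv_step_H[OF assms h(2)] by auto
  qed
qed

section \<open>Total charges against total gain\<close>

text \<open>After the last step nothing is due any more, so the debt alternative of the invariant is
  void.\<close>

lemma slack_T_nonneg: "0 \<le> slack T"
proof -
  have "t \<le> T \<Longrightarrow> invariant t" for t
    by (induction t) (auto simp: inv_Suc, simp add: invariant_def ref_0 slack_0)
  then have "invariant T" by blast
  moreover have "\<not> outstanding T e v" for e v by (auto simp: outstanding_def)
  ultimately show ?thesis unfolding invariant_def using w_nonneg
    by (force split: option.splits if_splits)
qed

text \<open>\<open>B\<close> holds the steps in which the adversary takes an item that the algorithm
  had before; \<open>p\<close> sends them to steps with \<open>later\<close>. It is injective
  because strictly increasing positions exclude taking an item twice.\<close>

lemma adv_le_charge: "(\<Sum>t<T. val (adv t)) \<le> (\<Sum>t<T. charge t)"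
proof -
  define B where "B = {t. t < T \<and> adv t \<noteq> None \<and> (\<exists>s<t. alg s = adv t)}"
  define p where "p t = (SOME s. s < t \<and> alg s = adv t)" for t
  have p: "p t < t" "alg (p t) = adv t" if "t \<in> B" for t
    using that someI_ex[of "\<lambda>s. s < t \<and> alg s = adv t"] unfolding B_def p_def by auto
  have "inj_on p B"
  proof (rule inj_onI)
    fix s t assume st: "s \<in> B" "t \<in> B" "p s = p t"
    with p have "adv s = adv t" by metis
    with st adv_ordered show "s = t" unfolding B_def
      by (smt (verit, best) linorder_neqE_nat mem_Collect_eq nat_neq_iff not_None_eq)
  qed
  have alg0: "0 \<le> val (alg s)" if "later s" for s
    using that adv_active w_nonneg unfolding later_def Q_def by force
  have fin: "finite B" unfolding B_def by simp
  have val: "val (adv t) = own t + (if t \<in> B then val (adv t) else 0)" if "t < T" for t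
    using that unfolding B_def own_def by (cases "adv t") auto
  have "(\<Sum>t<T. if t \<in> B then val (adv t) else 0) = (\<Sum>t\<in>B. val (alg (p t)))"
    using p by (intro sum.mono_neutral_cong_right) (auto simp: B_def)
  also have "\<dots> = (\<Sum>s\<in>p ` B. val (alg s))"
    using \<open>inj_on p B\<close> by (simp add: sum.reindex)
  also have "\<dots> = (\<Sum>s\<in>p ` B. if later s then val (alg s) else 0)"
  proof (rule sum.cong)
    fix s assume "s \<in> p ` B"
    then obtain t where "t \<in> B" "s = p t" by blast
    with p[of t] have "later s" unfolding later_def B_def by auto
    then show "val (alg s) = (if later s then val (alg s) else 0)" by simp
  qed simp
  also have "\<dots> \<le> (\<Sum>s<T. if later s then val (alg s) else 0)"
    using p fin alg0 by (intro sum_mono2) (auto simp: B_def intro: less_trans)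
  finally have "(\<Sum>t<T. if t \<in> B then val (adv t) else 0)
      \<le> (\<Sum>s<T. if later s then val (alg s) else 0)" .
  moreover have "(\<Sum>t<T. val (adv t))
      = (\<Sum>t<T. own t) + (\<Sum>t<T. if t \<in> B then val (adv t) else 0)"
    using val by (simp add: sum.distrib flip: sum.distrib)
  ultimately show ?thesis by (simp add: charge_def sum.distrib)
qed

theorem adv_le_alg: "(\<Sum>t<T. val (adv t)) \<le> 9/5 * (\<Sum>t<T. val (alg t))"
  using adv_le_charge slack_T_nonneg
  by (simp add: slack_def sum_subtractf sum_distrib_left)

end

section \<open>The FIFO queue as a suffix of the insertion sequence\<close>

lemma inserted_append [simp]: "inserted (us @ vs) = inserted us @ inserted vs"
  by (induction us rule: inserted.induct) auto

lemma queue_after_Nil [simp]: "queue_after [] = []"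
  by (simp add: queue_after_def)

lemma queue_after_snoc [simp]: "queue_after (us @ [u]) = apply_update (queue_after us) u"
  by (simp add: queue_after_def)

definition fifo_updates :: "update list \<Rightarrow> bool" where
  "fifo_updates us \<longleftrightarrow> (\<forall>as i x bs. us = as @ Insert i x # bs \<longrightarrow> i = length (queue_after as))"

lemma fifo_updates_appendD: "fifo_updates (us @ vs) \<Longrightarrow> fifo_updates us"
  unfolding fifo_updates_def by simp

lemma fifo_updates_snocD: "fifo_updates (us @ [Insert i x]) \<Longrightarrow> i = length (queue_after us)"
  unfolding fifo_updates_def by blast

text \<open>Measured by lengths, since \<open>Delete k\<close> may ask for more items than are
  left.\<close>

definition deleted :: "update list \<Rightarrow> nat" where
  "deleted us = length (inserted us) - length (queue_after us)"

lemma queue_after_suffix: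
  "fifo_updates us \<Longrightarrow> \<exists>k \<le> length (inserted us). queue_after us = drop k (inserted us)"
proof (induction us rule: rev_induct)
  case (snoc u us)
  then obtain k where k: "k \<le> length (inserted us)" "queue_after us = drop k (inserted us)"
    using fifo_updates_appendD by blast
  show ?case
  proof (cases u)
    case (Insert i x)
    with snoc.prems fifo_updates_snocD have "i = length (queue_after us)" by blast
    with k Insert show ?thesis by (intro exI[of _ k]) simp
  next
    case (Delete m)
    with k show ?thesis by (intro exI[of _ "min (m + k) (length (inserted us))"]) (simp add: min_def)
  qed
qed simp

lemma queue_after_eq_drop:
  "fifo_updates us \<Longrightarrow> queue_after us = drop (deleted us) (inserted us)"
  using queue_after_suffix[of us] by (auto simp: deleted_def)

text \<open>An insertion lengthens both lists by one; a deletion can only shorten the queue.\<close>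

lemma deleted_append: "fifo_updates (us @ vs) \<Longrightarrow> deleted us \<le> deleted (us @ vs)"
proof (induction vs rule: rev_induct)
  case (snoc v vs)
  have fifo: "fifo_updates (us @ vs)" using snoc.prems fifo_updates_appendD[of "us @ vs" "[v]"] by simp
  have "deleted (us @ vs) \<le> deleted ((us @ vs) @ [v])"
    unfolding deleted_def queue_after_snoc by (cases v) auto
  with snoc.IH[OF fifo] show ?case by simp
qed simp

section \<open>Exchanging inversions of a solution\<close>

text \<open>The summand may depend on the step, so that the lemma serves both the gain and the
  step-weighted potential.\<close>

lemma sum_swap:
  fixes g :: "nat \<Rightarrow> 'a \<Rightarrow> real"
  assumes "s < t" "t < length cs"
  shows "(\<Sum>i<length cs. g i (cs[s := cs ! t, t := cs ! s] ! i))
    = (\<Sum>i<length cs. g i (cs ! i)) - g s (cs ! s) - g t (cs ! t) + g s (cs ! t) + g t (cs ! s)"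
proof -
  have split: "(\<Sum>i<length cs. f i) = f s + f t + (\<Sum>i\<in>{..<length cs} - {s} - {t}. f i)"
    for f :: "nat \<Rightarrow> real"
    using assms by (simp add: sum.remove[of _ s] sum.remove[of _ t])
  have "(\<Sum>i\<in>{..<length cs} - {s} - {t}. g i (cs[s := cs ! t, t := cs ! s] ! i))
      = (\<Sum>i\<in>{..<length cs} - {s} - {t}. g i (cs ! i))"
    by (intro sum.cong) auto
  then show ?thesis
    using split[of "\<lambda>i. g i (cs[s := cs ! t, t := cs ! s] ! i)"] split[of "\<lambda>i. g i (cs ! i)"] assms
    by simp
qed

lemma gain_eq_sum:
  "gain cs = (\<Sum>t<length cs. case cs ! t of None \<Rightarrow> 0 | Some x \<Rightarrow> weight x)"
  by (simp add: gain_def sum_list_sum_nth atLeast0LessThan)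

lemma feasible_swap:
  assumes f: "feasible I cs" and st: "s < t" "t < length I"
    and x: "cs ! s = Some x" "x \<in> set (queue_at I t)"
    and y: "cs ! t = Some y" "y \<in> set (queue_at I s)"
  shows "feasible I (cs[s := cs ! t, t := cs ! s])"
proof -
  have len: "length cs = length I" using f by (simp add: feasible_def)
  have inj: "i = j" if "i < length I" "j < length I" "cs ! i = Some z" "cs ! j = Some z" for i j z
    using that f unfolding feasible_def by (metis linorder_neqE_nat)
  have act: "z \<in> set (queue_at I i)" if "i < length I" "cs ! i = Some z" for i z
    using that f unfolding feasible_def by blast
  \<comment> \<open>The transposition of \<open>s\<close> and \<open>t\<close>: its injectivity
    carries over that no item is collected twice.\<close>
  let ?p = "\<lambda>i. if i = s then t else if i = t then s else i"
  have nth: "cs[s := cs ! t, t := cs ! s] ! i = cs ! ?p i" if "i < length I" for i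
    using that len st by (auto simp: nth_list_update)
  show ?thesis unfolding feasible_def
  proof (intro conjI allI impI)
    fix i z assume i: "i < length I" and z: "cs[s := cs ! t, t := cs ! s] ! i = Some z"
    show "z \<in> set (queue_at I i)"
      using z nth[OF i] act[OF i] x y by (auto split: if_splits)
    fix j assume j: "j < i"
    show "cs[s := cs ! t, t := cs ! s] ! j \<noteq> Some z"
    proof
      assume "cs[s := cs ! t, t := cs ! s] ! j = Some z"
      with z nth i j have "cs ! ?p j = Some z" "cs ! ?p i = Some z" by auto
      with inj[of "?p j" "?p i"] st i j have "?p j = ?p i" by auto
      with j st show False by (auto split: if_splits)
    qed
  qed (use len in simp)
qed

text \<open>Swapping an inversion keeps a solution feasible and increases \<open>\<Sum>t. t * pos (cs ! t)\<close>.\<close>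

lemma ordered_solution:
  fixes pos :: "item \<Rightarrow> nat"
  assumes feas: "feasible I cs"
    and Q: "\<And>x t. x \<in> set (queue_at I t) \<longleftrightarrow> x \<in> U \<and> d t \<le> pos x \<and> pos x < n t"
    and "mono d" "mono n" "inj_on pos U"
  obtains cs' where "feasible I cs'" "gain cs' = gain cs"
    "\<And>s t x y. s < t \<Longrightarrow> t < length I \<Longrightarrow> cs' ! s = Some x \<Longrightarrow> cs' ! t = Some y \<Longrightarrow> pos x < pos y"
proof -
  define A where "A = {c. feasible I c \<and> gain c = gain cs}"
  define g :: "nat \<Rightarrow> item option \<Rightarrow> real" where
    "g t c = (case c of None \<Rightarrow> 0 | Some x \<Rightarrow> real t * real (pos x))" for t c
  define \<psi> where "\<psi> c = (\<Sum>t<length c. g t (c ! t))" for c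
  have fin: "finite (\<psi> ` A)" and ne: "\<psi> ` A \<noteq> {}"
    using finite_feasible[of I] feas by (auto simp: A_def)
  \<comment> \<open>A maximiser of the potential among feasible solutions of equal gain has no
    inversion left.\<close>
  obtain c where c: "c \<in> A" "\<psi> c = Max (\<psi> ` A)" using Max_in[OF fin ne] by auto
  then have f: "feasible I c" "gain c = gain cs" and len: "length c = length I"
    by (auto simp: A_def feasible_def)
  show ?thesis
  proof (rule that[OF f])
    fix s t x y assume st: "s < t" "t < length I" and x: "c ! s = Some x" and y: "c ! t = Some y"
    have xQ: "x \<in> set (queue_at I s)" and yQ: "y \<in> set (queue_at I t)" and "x \<noteq> y"
      using f(1) st x y unfolding feasible_def by (auto dest: less_trans)
    show "pos x < pos y"
    proof (rule ccontr)
      assume "\<not> pos x < pos y"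
      moreover have "pos x \<noteq> pos y"
        using xQ yQ Q \<open>x \<noteq> y\<close> \<open>inj_on pos U\<close> by (metis inj_onD)
      ultimately have lt: "pos y < pos x" by simp
      have "d s \<le> d t" "n s \<le> n t" using assms st by (auto simp: monoD)
      \<comment> \<open>Here \<open>d s \<le> d t \<le> pos y < pos x < n s \<le> n t\<close>, so
        both items are active at both steps.\<close>
      with xQ yQ Q lt have "x \<in> set (queue_at I t)" "y \<in> set (queue_at I s)" by auto
      with f st x y have sw: "feasible I (c[s := c ! t, t := c ! s])" by (intro feasible_swap)
      moreover have "gain (c[s := c ! t, t := c ! s]) = gain c"
        using sum_swap[of s t c "\<lambda>_ z. case z of None \<Rightarrow> 0 | Some x \<Rightarrow> weight x"] st len
        by (simp add: gain_eq_sum)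
      ultimately have "\<psi> (c[s := c ! t, t := c ! s]) \<le> \<psi> c"
        using f c fin by (auto simp: A_def intro!: Max_ge)
      moreover have "\<psi> (c[s := c ! t, t := c ! s])
          = \<psi> c + (real t - real s) * (real (pos x) - real (pos y))"
        using sum_swap[of s t c g] st len x y by (simp add: \<psi>_def g_def algebra_simps)
      moreover have "0 < (real t - real s) * (real (pos x) - real (pos y))"
        using st lt by simp
      ultimately show False by simp
    qed
  qed
qed

lemma opt_attained: obtains cs where "feasible I cs" "gain cs = opt I"
proof -
  have "opt I \<in> gain ` {cs. feasible I cs}"
    unfolding opt_def using finite_feasible[of I] feasible_idle[of I] by (intro Max_in) auto
  then show ?thesis using that by auto
qed

section \<open>The algorithm as a single run on the whole input\<close>

lemma queue_at_take: "t < m \<Longrightarrow> queue_at (take m I) t = queue_at I t"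
  by (simp add: queue_at_def min_def)

text \<open>The first \<open>t\<close> steps depend on the first \<open>t\<close> batches only.
  Hence recomputing the run on every revealed prefix agrees with one run on the full input.\<close>

lemma eh_state_take: "t \<le> m \<Longrightarrow> eh_state \<alpha> \<beta> sel (take m I) t = eh_state \<alpha> \<beta> sel I t"
  by (induction t) (simp_all add: queue_at_take min_def del: take_Suc)

definition eh_choice where
  "eh_choice \<alpha> \<beta> sel I t = last (fst (eh_state \<alpha> \<beta> sel I (Suc t)))"

lemma fst_eh_state: "fst (eh_state \<alpha> \<beta> sel I t) = map (eh_choice \<alpha> \<beta> sel I) [0..<t]"
  by (induction t) (auto simp: eh_choice_def Let_def split: prod.splits)

lemma outcome_eh: "outcome (fifo_queue_eh \<alpha> \<beta> sel) I = map (eh_choice \<alpha> \<beta> sel I) [0..<length I]"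
  by (auto simp: outcome_def fifo_queue_eh_def eh_choice_def eh_state_take min_absorb2 Suc_leI simp del: eh_state.simps)

definition eh_pending where
  "eh_pending \<alpha> \<beta> sel I t = filter (\<lambda>x. \<forall>s<t. eh_choice \<alpha> \<beta> sel I s \<noteq> Some x) (queue_at I t)"

text \<open>Removes the accumulated list of choices from the recursion, leaving the form that the
  game expects.\<close>

lemma eh_choice_step:
  "(eh_choice \<alpha> \<beta> sel I t, snd (eh_state \<alpha> \<beta> sel I (Suc t))) =
    eh_step \<alpha> \<beta> (eh_pending \<alpha> \<beta> sel I t)
      (sel (take (Suc t) I) (eh_pending \<alpha> \<beta> sel I t)) (snd (eh_state \<alpha> \<beta> sel I t))"
proof -
  obtain cs r where cr: "eh_state \<alpha> \<beta> sel I t = (cs, r)" by fastforce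
  then have "cs = map (eh_choice \<alpha> \<beta> sel I) [0..<t]" using fst_eh_state by (metis fst_conv)
  then have "filter (\<lambda>x. Some x \<notin> set cs) (queue_at I t) = eh_pending \<alpha> \<beta> sel I t"
    unfolding eh_pending_def by (intro filter_cong) (force simp: image_iff)+
  with cr have "eh_state \<alpha> \<beta> sel I (Suc t) = (let (c, r') =
      eh_step \<alpha> \<beta> (eh_pending \<alpha> \<beta> sel I t) (sel (take (Suc t) I) (eh_pending \<alpha> \<beta> sel I t)) r
      in (cs @ [c], r'))"
    by (simp only: eh_state.simps Let_def prod.case)
  with cr show ?thesis
    by (simp add: eh_choice_def Let_def case_prod_beta del: eh_state.simps)
qed

lemma eh_choice_pending:
  "eh_choice \<alpha> \<beta> sel I t = Some x \<Longrightarrow> x \<in> set (eh_pending \<alpha> \<beta> sel I t)"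
  using arg_cong[where f = fst, OF eh_choice_step[of \<alpha> \<beta> sel I t]]
  by (auto simp: eh_step_def find_Some_iff2 split: if_splits)

lemma feasible_eh: "feasible I (outcome (fifo_queue_eh \<alpha> \<beta> sel) I)"
  using eh_choice_pending[of \<alpha> \<beta> sel I] by (auto simp: feasible_def outcome_eh eh_pending_def)

text \<open>\<open>find\<close> returns the first hit, and in a sorted list every element with a
  smaller key stands before it.\<close>

lemma find_sorted_wrt:
  assumes "find p xs = Some e" "sorted_wrt (\<lambda>x y. f x < (f y :: nat)) xs"
  shows "e \<in> set xs \<and> p e \<and> (\<forall>x \<in> set xs. f x < f e \<longrightarrow> \<not> p x)"
proof -
  obtain i where i: "i < length xs" "p (xs ! i)" "e = xs ! i" "\<forall>j<i. \<not> p (xs ! j)"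
    using assms(1) by (auto simp: find_Some_iff)
  have "\<not> p (xs ! j)" if "j < length xs" "f (xs ! j) < f e" for j
  proof -
    have "\<not> i \<le> j" using that i assms(2) by (metis sorted_wrt_nth_less le_neq_implies_less less_asym less_irrefl)
    with i show ?thesis by simp
  qed
  with i show ?thesis by (auto simp: in_set_conv_nth)
qed

section \<open>Instantiating the game\<close>

theorem theorem6:
  fixes sel :: tie_breaking
  assumes "selects_heaviest sel"
  shows "competitive 1.8 {I. fifo_queue I} (fifo_queue_eh (3/4) (2/3) sel)"
proof -
  have "opt I \<le> 9/5 * gain (outcome (fifo_queue_eh (3/4) (2/3) sel) I)" if "fifo_queue I" for I
  proof -
    define xs where "xs = inserted (concat I)"
    have dist: "distinct xs" and wt: "\<And>x. x \<in> set xs \<Longrightarrow> 0 \<le> weight x"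
      and fifo: "fifo_updates (concat I)"
      using that by (auto simp: fifo_queue_def dynamic_queue_def fifo_updates_def xs_def)
    \<comment> \<open>Batch \<open>t\<close> precedes step \<open>t\<close>, hence
      \<open>Suc t\<close>. Past the last batch \<open>take\<close> saturates, so \<open>d\<close>
      and \<open>n\<close> are monotone on all of \<open>nat\<close>.\<close>
    define prefix where "prefix t = concat (take (Suc t) I)" for t
    define d n where "d t = deleted (prefix t)" and "n t = length (inserted (prefix t))" for t
    have prefix: "\<exists>vs. prefix t = prefix s @ vs" if "s \<le> t" for s t
    proof -
      have "take (Suc t) I = take (Suc s) I @ take (t - s) (drop (Suc s) I)"
        using that take_add[of "Suc s" "t - s" I] by simp
      then show ?thesis by (simp add: prefix_def)
    qed
    have all: "\<exists>vs. concat I = prefix t @ vs" for t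
      by (metis append_take_drop_id concat_append prefix_def)
    have fifo_prefix: "fifo_updates (prefix t)" for t
      using all fifo fifo_updates_appendD by metis
    have mono: "mono d" "mono n"
      unfolding d_def n_def
      by (intro monoI; metis prefix fifo_prefix deleted_append)
        (intro monoI; use prefix in fastforce)
    have queue: "queue_at I t = drop (d t) (take (n t) xs)" for t
    proof -
      have "inserted (prefix t) = take (n t) xs"
        using all[of t] by (auto simp: n_def xs_def)
      then show ?thesis using queue_after_eq_drop[OF fifo_prefix[of t]]
        by (simp add: queue_at_def prefix_def d_def)
    qed
    \<comment> \<open>As \<open>xs\<close> is distinct, this is the index of \<open>x\<close> in the
      insertion sequence.\<close>
    define pos where "pos x = (LEAST i. xs ! i = x)" for x
    have pos_nth: "pos (xs ! i) = i" if "i < length xs" for i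
      unfolding pos_def using that dist
      by (intro Least_equality) (auto simp: nth_eq_iff_index_eq, metis leI le_less_trans less_imp_le_nat nth_eq_iff_index_eq)
    have inj: "inj_on pos (set xs)" using pos_nth by (metis in_set_conv_nth inj_onI)
    have Q: "x \<in> set (queue_at I t) \<longleftrightarrow> x \<in> set xs \<and> d t \<le> pos x \<and> pos x < n t" for x t
    proof
      assume "x \<in> set (queue_at I t)"
      then obtain i where "i < length (queue_at I t)" "x = queue_at I t ! i"
        by (auto simp: in_set_conv_nth)
      moreover from this have "d t + i < min (length xs) (n t)"
        unfolding queue length_drop length_take by linarith
      ultimately have "d t + i < length xs" "d t + i < n t" "x = xs ! (d t + i)"
        by (simp_all add: queue)
      with pos_nth show "x \<in> set xs \<and> d t \<le> pos x \<and> pos x < n t" by auto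
    next
      assume "x \<in> set xs \<and> d t \<le> pos x \<and> pos x < n t"
      moreover from this obtain i where "i < length xs" "x = xs ! i" by (auto simp: in_set_conv_nth)
      ultimately have "x = queue_at I t ! (i - d t)" "i - d t < length (queue_at I t)"
        using pos_nth by (auto simp: queue)
      then show "x \<in> set (queue_at I t)" by simp
    qed
    have sorted: "sorted_wrt (\<lambda>x y. pos x < pos y) xs"
      using pos_nth by (simp add: sorted_wrt_iff_nth_less)
    obtain cs0 where "feasible I cs0" "gain cs0 = opt I" by (rule opt_attained)
    then obtain cs where cs: "feasible I cs" "gain cs = opt I" and
      ord: "\<And>s t x y. s < t \<Longrightarrow> t < length I \<Longrightarrow> cs ! s = Some x \<Longrightarrow> cs ! t = Some y \<Longrightarrow> pos x < pos y"
      using ordered_solution[OF _ Q mono inj] by metis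
    let ?alg = "eh_choice (3/4) (2/3) sel I" and ?P = "eh_pending (3/4) (2/3) sel I"
    let ?ref = "\<lambda>t. snd (eh_state (3/4) (2/3) sel I t)"
    have heaviest: "sel H P \<in> set P" "x \<in> set P \<Longrightarrow> weight x \<le> weight (sel H P)" if "P \<noteq> []" for H P x
      using assms that by (auto simp: selects_heaviest_def)
    have pending: "set (?P t) = {x \<in> {x \<in> set xs. d t \<le> pos x \<and> pos x < n t}. \<forall>s<t. ?alg s \<noteq> Some x}" for t
      using Q by (auto simp: eh_pending_def)
    have idle: "?alg t = None \<and> ?ref (Suc t) = ?ref t" if "?P t = []" for t
      using eh_choice_step[of "3/4" "2/3" sel I t] that by (simp add: eh_step_def del: eh_state.simps)
    have step: "\<exists>h \<in> set (?P t). (\<forall>x \<in> set (?P t). weight x \<le> weight h) \<and>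
        (if ?ref t \<notin> Some ` set (?P t) \<or> 3/4 * weight h \<ge> weight (the (?ref t))
         then ?ref (Suc t) = Some h \<and>
           (\<exists>e \<in> set (?P t). ?alg t = Some e \<and> 2/3 * weight h \<le> weight e \<and>
              (\<forall>x \<in> set (?P t). pos x < pos e \<longrightarrow> weight x < 2/3 * weight h))
         else ?alg t = ?ref t \<and> ?ref (Suc t) = ?ref t)" if ne: "?P t \<noteq> []" for t
    proof -
      define h where "h = sel (take (Suc t) I) (?P t)"
      have h: "h \<in> set (?P t)" "\<forall>x \<in> set (?P t). weight x \<le> weight h"
        using heaviest ne unfolding h_def by auto
      then have "0 \<le> weight h" using pending wt by auto
      \<comment> \<open>Nonnegative weights let \<open>h\<close> itself pass the test.\<close>
      then have "find (\<lambda>e. 2/3 * weight h \<le> weight e) (?P t) \<noteq> None"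
        using h(1) by (auto simp: find_None_iff)
      then obtain e where e: "find (\<lambda>e. 2/3 * weight h \<le> weight e) (?P t) = Some e" by blast
      have "sorted_wrt (\<lambda>x y. pos x < pos y) (?P t)"
        unfolding eh_pending_def queue
        by (intro sorted_wrt_filter sorted_wrt_drop sorted_wrt_take sorted)
      from find_sorted_wrt[OF e this] have "e \<in> set (?P t) \<and> 2/3 * weight h \<le> weight e \<and>
          (\<forall>x \<in> set (?P t). pos x < pos e \<longrightarrow> weight x < 2/3 * weight h)"
        by auto
      with h eh_choice_step[of "3/4" "2/3" sel I t, folded h_def] ne e show ?thesis
        by (intro bexI[of _ h]) (auto simp: eh_step_def simp del: eh_state.simps)
    qed
    interpret fifo_game weight pos "set xs" d n "length I" ?alg "\<lambda>t. cs ! t" ?ref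
      "\<lambda>t. {x \<in> set xs. d t \<le> pos x \<and> pos x < n t}"
      "\<lambda>t. {x \<in> {x \<in> set xs. d t \<le> pos x \<and> pos x < n t}. \<forall>s<t. ?alg s \<noteq> Some x}"
    \<comment> \<open>Folding the comprehension back into \<open>set (?P t)\<close> gives the goals
      the form of \<open>idle\<close> and \<open>step\<close>.\<close>
    proof (unfold_locales, unfold pending[symmetric])
      show "x \<in> {x \<in> set xs. d t \<le> pos x \<and> pos x < n t}" if "t < length I" "cs ! t = Some x" for t x
        using cs that Q by (auto simp: feasible_def)
    qed (use mono inj wt ord idle step in \<open>simp_all del: eh_state.simps(2)\<close>)
    have "gain cs = (\<Sum>t<length I. val (cs ! t))"
      using cs by (simp add: gain_eq_sum val_def feasible_def)
    moreover have "gain (outcome (fifo_queue_eh (3/4) (2/3) sel) I) = (\<Sum>t<length I. val (?alg t))"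
      by (simp add: gain_eq_sum val_def outcome_eh)
    ultimately show ?thesis using adv_le_alg cs by simp
  qed
  with feasible_eh show ?thesis by (fastforce simp: competitive_def field_simps)
qed

end
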